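(* Let $X$ be a uniformly convex and smooth Banach space and let $P_1$ and $P_2$ be two linear projections on $X$ of norm one. Then $P_1$ and $P_2$ are consistent, that is, there is a bounded linear projection $P_{12}: X\to X$ with image $\operatorname{im} P_{12} = \operatorname{im} P_1\cap \operatorname{im} P_2$ such that $P_{12}P_1 = P_{12}P_2 = P_{12}$.
   Context: A linear projection on a Banach space $X$ is a linear map $P: X\to X$ with $P^2=P$; norm-one means that its operator norm equals $1$. *)

theory Defs
  imports "HOL-Analysis.Analysis"
begin

(* The type class banach provides completeness and the real scalar multiplication; the locale
   adds a scalar field 'k acting compatibly with both.  A real_normed_field has a multiplicative
   norm, so by Gelfand-Mazur it is, up to isometric isomorphism, the real or the complex numbers:
   the locale covers real and complex Banach spaces at once. *)
locale banach_space_over = vector_space scl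
  for scl :: "'k::real_normed_field \<Rightarrow> 'a::banach \<Rightarrow> 'a" +
  assumes scl_of_real: "scl (of_real r) x = r *\<^sub>R x"
    and norm_scl: "norm (scl c x) = norm c * norm x"

lemma banach_space_over_scaleR: "banach_space_over (scaleR :: real \<Rightarrow> 'a::banach \<Rightarrow> 'a)"
  by unfold_locales (simp_all add: algebra_simps)

lemma banach_space_over_complex: "banach_space_over ((*) :: complex \<Rightarrow> complex \<Rightarrow> complex)"
  by unfold_locales (simp_all add: algebra_simps norm_mult scaleR_conv_of_real)

definition uniformly_convex :: "'a::real_normed_vector itself \<Rightarrow> bool" where
  "uniformly_convex _ \<longleftrightarrow>
    (\<forall>\<epsilon>>0. \<exists>\<delta>>0. \<forall>x y :: 'a. norm x = 1 \<longrightarrow> norm y = 1 \<longrightarrow> norm (x - y) \<ge> \<epsilon> \<longrightarrow>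
       norm ((1/2) *\<^sub>R (x + y)) \<le> 1 - \<delta>)"

(* bounded_linear is real-linear boundedness; linearity over 'k is the separate first conjunct. *)
definition support_functional ::
    "('k::real_normed_field \<Rightarrow> 'a::banach \<Rightarrow> 'a) \<Rightarrow> 'a \<Rightarrow> ('a \<Rightarrow> 'k) \<Rightarrow> bool" where
  "support_functional scl x f \<longleftrightarrow>
    Vector_Spaces.linear scl (*) f \<and> bounded_linear f \<and> onorm f = 1 \<and> f x = of_real (norm x)"

definition smooth_space :: "('k::real_normed_field \<Rightarrow> 'a::banach \<Rightarrow> 'a) \<Rightarrow> bool" where
  "smooth_space scl \<longleftrightarrow> (\<forall>x. norm x = 1 \<longrightarrow> (\<exists>!f. support_functional scl x f))"

definition linear_projection ::
    "('k::real_normed_field \<Rightarrow> 'a::banach \<Rightarrow> 'a) \<Rightarrow> ('a \<Rightarrow> 'a) \<Rightarrow> bool" where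
  "linear_projection scl P \<longleftrightarrow> Vector_Spaces.linear scl scl P \<and> P \<circ> P = P"

(* onorm is meaningful only for bounded maps, hence the explicit boundedness. *)
definition norm_one :: "('a::banach \<Rightarrow> 'a) \<Rightarrow> bool" where
  "norm_one P \<longleftrightarrow> bounded_linear P \<and> onorm P = 1"

definition consistent ::
    "('k::real_normed_field \<Rightarrow> 'a::banach \<Rightarrow> 'a) \<Rightarrow> ('a \<Rightarrow> 'a) \<Rightarrow> ('a \<Rightarrow> 'a) \<Rightarrow> bool" where
  "consistent scl P\<^sub>1 P\<^sub>2 \<longleftrightarrow>
    (\<exists>P\<^sub>1\<^sub>2. linear_projection scl P\<^sub>1\<^sub>2 \<and> bounded_linear P\<^sub>1\<^sub>2 \<and>
       range P\<^sub>1\<^sub>2 = range P\<^sub>1 \<inter> range P\<^sub>2 \<and> P\<^sub>1\<^sub>2 \<circ> P\<^sub>1 = P\<^sub>1\<^sub>2 \<and> P\<^sub>1\<^sub>2 \<circ> P\<^sub>2 = P\<^sub>1\<^sub>2)"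

end

theory Submission
  imports Defs
begin

text \<open>
  Let \<open>Y\<close> be the intersection of the two ranges and let \<open>K\<close> be the common kernel of the support
  functionals at the unit vectors of \<open>Y\<close>. The space splits as \<open>Y \<oplus> K\<close>, and \<open>P\<^sub>1\<^sub>2\<close> is the projection
  onto \<open>Y\<close> along \<open>K\<close>.

  Smoothness links \<open>K\<close> with the given projections. If \<open>z\<close> is a unit vector with \<open>P z = z\<close> and \<open>f\<close>
  supports \<open>z\<close>, then so does \<open>f \<circ> P\<close>, because \<open>P\<close> is a contraction; hence \<open>f \<circ> P = f\<close>
  (\<open>support_functional_invariant\<close>). So \<open>x - P\<^sub>i x\<close> always lies in \<open>K\<close>, that is, \<open>P\<^sub>1\<close> and \<open>P\<^sub>2\<close> map
  every coset \<open>x + K\<close> into itself.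

  Uniform convexity produces the splitting. The coset \<open>x + K\<close> is closed and convex, so it has exactly
  one element \<open>m\<close> of least norm (\<open>uniformly_convex_ex1_least_norm\<close>). As \<open>P\<^sub>i m\<close> lies in the same coset
  and is no longer than \<open>m\<close>, it equals \<open>m\<close>; so \<open>m \<in> Y\<close> and \<open>x - m \<in> K\<close>. The sum is direct, since a
  support functional at the direction of \<open>y \<in> Y\<close> takes the value \<open>norm y\<close> at \<open>y\<close>. Finally
  \<open>norm m \<le> norm x\<close> makes \<open>P\<^sub>1\<^sub>2\<close> bounded, and \<open>P\<^sub>1\<^sub>2 P\<^sub>i = P\<^sub>1\<^sub>2\<close> holds because \<open>x\<close> and \<open>P\<^sub>i x\<close> lie in the
  same coset.
\<close>

section \<open>Shortest elements of convex sets\<close>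

text \<open>
  Two almost shortest elements of a convex set have almost the same direction: their midpoint is
  again in the set, hence not much shorter, and uniform convexity forbids this for directions far
  apart.
\<close>

lemma uniformly_convex_almost_shortest:
  fixes C :: "'a::banach set"
  assumes uc: "uniformly_convex TYPE('a)" and "convex C" and "0 < d"
    and d: "\<And>x. x \<in> C \<Longrightarrow> d \<le> norm x" and "0 < \<epsilon>"
  obtains \<eta> where "0 < \<eta>"
    "\<And>x y. x \<in> C \<Longrightarrow> y \<in> C \<Longrightarrow> norm x < d + \<eta> \<Longrightarrow> norm y < d + \<eta> \<Longrightarrow> norm (sgn x - sgn y) < \<epsilon>"
proof -
  obtain \<delta> where "0 < \<delta>" and \<delta>: "\<And>x y::'a. norm x = 1 \<Longrightarrow> norm y = 1 \<Longrightarrow> \<epsilon> \<le> norm (x - y) \<Longrightarrow>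
      norm ((1/2) *\<^sub>R (x + y)) \<le> 1 - \<delta>"
    using uc \<open>0 < \<epsilon>\<close> unfolding uniformly_convex_def by metis
  have "norm (sgn x - sgn y) < \<epsilon>"
    if xy: "x \<in> C" "y \<in> C" "norm x < d + d * \<delta>" "norm y < d + d * \<delta>" for x y
  proof (rule ccontr)
    assume "\<not> norm (sgn x - sgn y) < \<epsilon>"
    moreover have nz: "x \<noteq> 0" "y \<noteq> 0" using d xy \<open>0 < d\<close> by fastforce+
    ultimately have far: "norm ((1/2) *\<^sub>R (sgn x + sgn y)) \<le> 1 - \<delta>"
      by (intro \<delta>) (auto simp: norm_sgn)
    \<comment> \<open>Moving both points radially to the sphere of radius \<open>d\<close> costs less than the gain \<open>d * \<delta>\<close>.\<close>
    have excess: "norm (z - d *\<^sub>R sgn z) = norm z - d" if "z \<in> C" "z \<noteq> 0" for z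
    proof -
      have "z - d *\<^sub>R sgn z = (norm z - d) *\<^sub>R sgn z"
        using that by (simp add: sgn_div_norm algebra_simps)
      then show ?thesis using d[OF that(1)] that by (simp add: norm_sgn)
    qed
    have "(1/2) *\<^sub>R x + (1/2) *\<^sub>R y \<in> C"
      using \<open>convex C\<close> xy by (intro convexD) auto
    then have "d \<le> norm ((1/2) *\<^sub>R x + (1/2) *\<^sub>R y)" by (rule d)
    also have "(1/2) *\<^sub>R x + (1/2) *\<^sub>R y =
        d *\<^sub>R ((1/2) *\<^sub>R (sgn x + sgn y)) + ((1/2) *\<^sub>R (x - d *\<^sub>R sgn x) + (1/2) *\<^sub>R (y - d *\<^sub>R sgn y))"
      by (simp add: algebra_simps)
    also have "norm \<dots> \<le> norm (d *\<^sub>R ((1/2) *\<^sub>R (sgn x + sgn y)))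
        + (norm ((1/2) *\<^sub>R (x - d *\<^sub>R sgn x)) + norm ((1/2) *\<^sub>R (y - d *\<^sub>R sgn y)))"
      by (meson norm_triangle_ineq add_left_mono order_trans)
    also have "\<dots> = d * norm ((1/2) *\<^sub>R (sgn x + sgn y)) + ((norm x - d) / 2 + (norm y - d) / 2)"
      using \<open>0 < d\<close> excess xy nz by simp
    also have "\<dots> < d * (1 - \<delta>) + d * \<delta>"
      using mult_left_mono[OF far, of d] xy \<open>0 < d\<close> by argo
    finally show False by (simp add: algebra_simps)
  qed
  then show ?thesis using that[of "d * \<delta>"] \<open>0 < d\<close> \<open>0 < \<delta>\<close> by simp
qed

text \<open>
  When the distance \<open>d\<close> from \<open>0\<close> to \<open>C\<close> is positive, the directions of a minimising sequence form a
  Cauchy sequence, so the sequence itself converges since its norms do. Uniqueness is the same estimate applied to two shortest elements.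
\<close>

lemma uniformly_convex_ex1_least_norm:
  fixes C :: "'a::banach set"
  assumes uc: "uniformly_convex TYPE('a)" and "convex C" and "closed C" and "C \<noteq> {}"
  shows "\<exists>!m. m \<in> C \<and> (\<forall>x\<in>C. norm m \<le> norm x)"
proof -
  define d where "d = Inf (norm ` C)"
  have bdd: "bdd_below (norm ` C)" by (auto intro: bdd_belowI[of _ 0])
  have d: "d \<le> norm x" if "x \<in> C" for x
    unfolding d_def using bdd that by (simp add: cInf_lower)
  have "\<exists>x\<in>C. norm x < d + inverse (real (Suc n))" for n
    using cInf_lessD[of "norm ` C" "d + inverse (real (Suc n))"] \<open>C \<noteq> {}\<close> by (simp add: d_def)
  then obtain s where s: "\<And>n. s n \<in> C" "\<And>n. norm (s n) < d + inverse (real (Suc n))" by metis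
  have lim_norm: "(\<lambda>n. norm (s n)) \<longlonglongrightarrow> d"
  proof (rule tendsto_sandwich)
    show "\<forall>\<^sub>F n in sequentially. d \<le> norm (s n)" using s d by simp
    show "\<forall>\<^sub>F n in sequentially. norm (s n) \<le> d + inverse (real (Suc n))"
      using less_imp_le[OF s(2)] by (rule always_eventually[OF allI])
    show "(\<lambda>n. d + inverse (real (Suc n))) \<longlonglongrightarrow> d"
      using tendsto_add[OF tendsto_const LIMSEQ_inverse_real_of_nat, of d] by simp
  qed simp
  have "0 \<le> d" unfolding d_def using \<open>C \<noteq> {}\<close> by (intro cInf_greatest) auto
  show ?thesis
  proof (cases "d = 0")
    \<comment> \<open>Directions carry no information when the minimising sequence tends to \<open>0\<close>.\<close>
    case True
    then have "s \<longlonglongrightarrow> 0" using lim_norm by (simp add: tendsto_norm_zero_iff)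
    then have "0 \<in> C" using \<open>closed C\<close> s closed_sequentially by blast
    then show ?thesis by (intro ex1I[of _ 0]) force+
  next
    case False
    then have "0 < d" using \<open>0 \<le> d\<close> by simp
    have "Cauchy (\<lambda>n. sgn (s n))"
    proof (rule metric_CauchyI)
      fix \<epsilon> :: real assume "0 < \<epsilon>"
      from uniformly_convex_almost_shortest[OF uc \<open>convex C\<close> \<open>0 < d\<close> d this]
      obtain \<eta> where "0 < \<eta>" and \<eta>: "\<And>x y. x \<in> C \<Longrightarrow> y \<in> C \<Longrightarrow> norm x < d + \<eta> \<Longrightarrow>
          norm y < d + \<eta> \<Longrightarrow> norm (sgn x - sgn y) < \<epsilon>" by metis
      obtain N where "\<And>n. n \<ge> N \<Longrightarrow> norm (s n) < d + \<eta>"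
        using order_tendstoD(2)[OF lim_norm, of "d + \<eta>"] \<open>0 < \<eta>\<close>
        by (auto simp: eventually_sequentially)
      then show "\<exists>N. \<forall>m\<ge>N. \<forall>n\<ge>N. dist (sgn (s m)) (sgn (s n)) < \<epsilon>"
        using \<eta> s(1) by (intro exI[of _ N]) (simp add: dist_norm)
    qed
    then obtain u where "(\<lambda>n. sgn (s n)) \<longlonglongrightarrow> u"
      using Cauchy_convergent convergent_def by blast
    then have "(\<lambda>n. norm (s n) *\<^sub>R sgn (s n)) \<longlonglongrightarrow> d *\<^sub>R u" by (intro tendsto_intros lim_norm)
    moreover have "norm x *\<^sub>R sgn x = x" for x :: 'a by (cases "x = 0") (simp_all add: sgn_div_norm)
    ultimately have "s \<longlonglongrightarrow> d *\<^sub>R u" by simp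
    then have u: "d *\<^sub>R u \<in> C" "norm (d *\<^sub>R u) = d"
      by (rule closed_sequentially[OF \<open>closed C\<close> s(1)], rule LIMSEQ_unique[OF tendsto_norm lim_norm])
    have inj: "x = y" if xy: "x \<in> C" "y \<in> C" "norm x = d" "norm y = d" for x y
    proof -
      have "norm (sgn x - sgn y) < \<epsilon>" if "0 < \<epsilon>" for \<epsilon>
      proof -
        from uniformly_convex_almost_shortest[OF uc \<open>convex C\<close> \<open>0 < d\<close> d that]
        obtain \<eta> where "0 < \<eta>" and \<eta>: "\<And>x y. x \<in> C \<Longrightarrow> y \<in> C \<Longrightarrow> norm x < d + \<eta> \<Longrightarrow>
            norm y < d + \<eta> \<Longrightarrow> norm (sgn x - sgn y) < \<epsilon>" by metis
        then show ?thesis using xy by simp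
      qed
      then have "sgn x = sgn y"
        by (metis less_irrefl right_minus_eq zero_less_norm_iff)
      moreover have "x = d *\<^sub>R sgn x" "y = d *\<^sub>R sgn y"
        using xy \<open>0 < d\<close> by (auto simp: sgn_div_norm)
      ultimately show ?thesis by simp
    qed
    show ?thesis
    proof (rule ex1I)
      show "d *\<^sub>R u \<in> C \<and> (\<forall>x\<in>C. norm (d *\<^sub>R u) \<le> norm x)" using u d by metis
    next
      fix m assume m: "m \<in> C \<and> (\<forall>x\<in>C. norm m \<le> norm x)"
      then have "norm m \<le> d" using u by metis
      then show "m = d *\<^sub>R u" using inj[of m "d *\<^sub>R u"] m u d[of m] by linarith
    qed
  qed
qed

section \<open>Support functionals of smooth spaces\<close>

text \<open>Both \<open>f\<close> and \<open>f \<circ> P\<close> support \<open>z\<close>, and smoothness allows only one support functional.\<close>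

lemma support_functional_invariant:
  fixes scl :: "'k::real_normed_field \<Rightarrow> 'a::banach \<Rightarrow> 'a"
  assumes "smooth_space scl" and "Vector_Spaces.linear scl scl P" and "norm_one P"
    and f: "support_functional scl z f" and "norm z = 1" and "P z = z"
  shows "f (P x) = f x"
proof -
  have P: "bounded_linear P" "onorm P = 1" using assms by (auto simp: norm_one_def)
  have bf: "bounded_linear f" "onorm f = 1" "f z = of_real (norm z)"
    "Vector_Spaces.linear scl (*) f"
    using f by (auto simp: support_functional_def)
  have b: "bounded_linear (f \<circ> P)"
    using bounded_linear_compose[OF bf(1) P(1)] by (simp add: o_def)
  have "onorm (f \<circ> P) \<le> 1" using onorm_compose[OF bf(1) P(1)] P bf by simp
  moreover have "1 \<le> onorm (f \<circ> P)"
    using onorm[OF b, of z] bf assms by simp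
  moreover have "Vector_Spaces.linear scl (*) (f \<circ> P)"
    using bf(4) assms(2) by (simp add: Vector_Spaces.linear_iff)
  ultimately have "support_functional scl z (f \<circ> P)"
    using b bf assms by (simp add: support_functional_def)
  then have "f \<circ> P = f" using assms unfolding smooth_space_def by blast
  then show ?thesis by (metis comp_apply)
qed

definition support_annihilator ::
    "('k::real_normed_field \<Rightarrow> 'a::banach \<Rightarrow> 'a) \<Rightarrow> 'a set \<Rightarrow> 'a set" where
  "support_annihilator scl Y =
    {u. \<forall>z f. z \<in> Y \<longrightarrow> norm z = 1 \<longrightarrow> support_functional scl z f \<longrightarrow> f u = 0}"

lemma subspace_support_annihilator: "subspace (support_annihilator scl Y)"
  unfolding support_annihilator_def subspace_def support_functional_def
  by (auto simp: linear_simps) (metis add.right_neutral)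

lemma scl_support_annihilator:
  "u \<in> support_annihilator scl Y \<Longrightarrow> scl c u \<in> support_annihilator scl Y"
  unfolding support_annihilator_def support_functional_def by (auto simp: Vector_Spaces.linear_iff)

lemma closed_support_annihilator: "closed (support_annihilator scl Y)"
proof -
  have "support_annihilator scl Y =
      (\<Inter>f \<in> {f. \<exists>z\<in>Y. norm z = 1 \<and> support_functional scl z f}. {u. f u = 0})"
    by (auto simp: support_annihilator_def)
  moreover have "closed {u. f u = 0}" if "support_functional scl z f" for z f
    using that by (intro closed_Collect_eq continuous_on_const)
      (auto simp: support_functional_def linear_continuous_on)
  ultimately show ?thesis by auto
qed

text \<open>A support functional at the direction of \<open>y\<close> takes the value \<open>norm y\<close> at \<open>y\<close> itself.\<close>

lemma support_annihilator_disjoint: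
  fixes scl :: "'k::real_normed_field \<Rightarrow> 'a::banach \<Rightarrow> 'a"
  assumes "smooth_space scl" and "subspace Y" and "y \<in> Y" and "y \<in> support_annihilator scl Y"
  shows "y = 0"
proof (rule ccontr)
  assume "y \<noteq> 0"
  then have n: "norm (sgn y) = 1" by (simp add: norm_sgn)
  then obtain f where f: "support_functional scl (sgn y) f"
    using assms(1) unfolding smooth_space_def by blast
  have "sgn y \<in> Y" "sgn y \<in> support_annihilator scl Y"
    using assms subspace_support_annihilator[of scl Y] by (auto simp: sgn_div_norm subspace_scale)
  then have "f (sgn y) = 0" using f n by (auto simp: support_annihilator_def)
  then show False using f n by (auto simp: support_functional_def)
qed

section \<open>Splitting along the common kernel\<close>

text \<open>
  The contraction \<open>P\<close> moves points only by vectors of \<open>K\<close>, so it maps the shortest element of \<open>x + K\<close>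
  to an element of \<open>x + K\<close> that is at most as long.
\<close>

lemma least_norm_in_coset_fixed:
  fixes K :: "'a::banach set"
  assumes uc: "uniformly_convex TYPE('a)" and K: "subspace K" "closed K"
  obtains m where "x - m \<in> K" "norm m \<le> norm x"
    "\<And>P. norm_one P \<Longrightarrow> (\<And>u. u - P u \<in> K) \<Longrightarrow> P m = m"
proof -
  define C where "C = (\<lambda>u. x - u) -` K"
  have "convex C"
  proof (rule convexI)
    fix a b :: 'a and s t :: real
    assume h: "a \<in> C" "b \<in> C" "s + t = 1"
    have "x = (s + t) *\<^sub>R x" using h by simp
    then have "x - (s *\<^sub>R a + t *\<^sub>R b) = s *\<^sub>R (x - a) + t *\<^sub>R (x - b)"
      by (simp add: algebra_simps)
    then show "s *\<^sub>R a + t *\<^sub>R b \<in> C"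
      using h K by (simp add: C_def subspace_add subspace_scale)
  qed
  moreover have "closed C"
    unfolding C_def by (intro closed_vimage K continuous_intros)
  moreover have "x \<in> C" using K by (simp add: C_def subspace_0)
  ultimately obtain m where m: "m \<in> C" "\<And>u. u \<in> C \<Longrightarrow> norm m \<le> norm u"
    and unique: "\<And>m'. m' \<in> C \<Longrightarrow> (\<And>u. u \<in> C \<Longrightarrow> norm m' \<le> norm u) \<Longrightarrow> m' = m"
    using uniformly_convex_ex1_least_norm[OF uc, of C] by blast
  show ?thesis
  proof
    show "x - m \<in> K" "norm m \<le> norm x" using m \<open>x \<in> C\<close> by (auto simp: C_def)
    fix P assume P: "norm_one P" "\<And>u. u - P u \<in> K"
    have "x - P m = (x - m) + (m - P m)" by simp
    then have "P m \<in> C" using subspace_add[OF K(1) \<open>x - m \<in> K\<close> P(2)[of m]] by (simp add: C_def)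
    moreover have "norm (P m) \<le> norm m"
      using P(1) onorm[of P m] by (simp add: norm_one_def)
    ultimately show "P m = m" using m unique order_trans by blast
  qed
qed

theorem proposition4:
  fixes scl :: "'k::real_normed_field \<Rightarrow> 'a::banach \<Rightarrow> 'a"
    and P\<^sub>1 P\<^sub>2 :: "'a \<Rightarrow> 'a"
  assumes "banach_space_over scl"
    and "uniformly_convex TYPE('a)"
    and "smooth_space scl"
    and "linear_projection scl P\<^sub>1" and "norm_one P\<^sub>1"
    and "linear_projection scl P\<^sub>2" and "norm_one P\<^sub>2"
  shows "consistent scl P\<^sub>1 P\<^sub>2"
proof -
  interpret V: banach_space_over scl by fact
  have linear: "Vector_Spaces.linear scl scl P\<^sub>1" "Vector_Spaces.linear scl scl P\<^sub>2"
    and "P\<^sub>1 \<circ> P\<^sub>1 = P\<^sub>1" "P\<^sub>2 \<circ> P\<^sub>2 = P\<^sub>2"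
    using assms by (auto simp: linear_projection_def)
  then have range_iff: "y \<in> range P\<^sub>1 \<longleftrightarrow> P\<^sub>1 y = y" "y \<in> range P\<^sub>2 \<longleftrightarrow> P\<^sub>2 y = y" for y
    by (auto simp: fun_eq_iff image_iff) metis+
  have P\<^sub>i_scl: "P\<^sub>1 (scl c x) = scl c (P\<^sub>1 x)" "P\<^sub>2 (scl c x) = scl c (P\<^sub>2 x)" for c x
    using linear by (simp_all add: Vector_Spaces.linear_iff)
  define Y where "Y = range P\<^sub>1 \<inter> range P\<^sub>2"
  define K where "K = support_annihilator scl Y"
  have Y_iff: "y \<in> Y \<longleftrightarrow> P\<^sub>1 y = y \<and> P\<^sub>2 y = y" for y by (simp add: Y_def range_iff)
  have bl: "bounded_linear P\<^sub>1" "bounded_linear P\<^sub>2" using assms by (auto simp: norm_one_def)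
  have subspace_Y: "subspace Y"
    by (auto simp: subspace_def Y_iff linear_simps[OF bl(1)] linear_simps[OF bl(2)])
  have scl_Y: "scl c y \<in> Y" if "y \<in> Y" for c y using that by (simp add: Y_iff P\<^sub>i_scl)
  have subspace_K: "subspace K" by (simp add: K_def subspace_support_annihilator)
  have scl_K: "scl c u \<in> K" if "u \<in> K" for c u using that by (simp add: K_def scl_support_annihilator)
  have move: "u - P\<^sub>1 u \<in> K" "u - P\<^sub>2 u \<in> K" for u
  proof -
    have "f (u - P\<^sub>1 u) = 0 \<and> f (u - P\<^sub>2 u) = 0"
      if "z \<in> Y" "norm z = 1" "support_functional scl z f" for z f
    proof -
      have "bounded_linear f" using that by (simp add: support_functional_def)
      then show ?thesis
        using that support_functional_invariant[OF assms(3) linear(1) assms(5) that(3,2)]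
          support_functional_invariant[OF assms(3) linear(2) assms(7) that(3,2)]
        by (simp add: Y_iff linear_simps)
    qed
    then show "u - P\<^sub>1 u \<in> K" "u - P\<^sub>2 u \<in> K" by (auto simp: K_def support_annihilator_def)
  qed
  have "\<exists>m. m \<in> Y \<and> x - m \<in> K \<and> norm m \<le> norm x" for x
  proof -
    have "closed K" by (simp add: K_def closed_support_annihilator)
    from least_norm_in_coset_fixed[OF assms(2) subspace_K this, of x]
    obtain m where "x - m \<in> K" "norm m \<le> norm x"
      "\<And>P. norm_one P \<Longrightarrow> (\<And>u. u - P u \<in> K) \<Longrightarrow> P m = m" by metis
    then show ?thesis using move assms by (auto simp: Y_iff)
  qed
  then obtain P where P: "\<And>x. P x \<in> Y" "\<And>x. x - P x \<in> K" "\<And>x. norm (P x) \<le> norm x" by metis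
  have P_eqI: "P x = m" if "m \<in> Y" "x - m \<in> K" for x m
  proof -
    have "P x - m \<in> Y" using that P subspace_Y by (simp add: subspace_diff)
    moreover have "P x - m \<in> K" using subspace_diff[OF subspace_K that(2) P(2)[of x]] by simp
    ultimately have "P x - m = 0"
      using support_annihilator_disjoint[OF assms(3) subspace_Y] K_def by blast
    then show ?thesis by simp
  qed
  have P_add: "P (x + y) = P x + P y" for x y
  proof (rule P_eqI)
    show "P x + P y \<in> Y" using P subspace_Y by (simp add: subspace_add)
    show "x + y - (P x + P y) \<in> K"
      using subspace_add[OF subspace_K P(2)[of x] P(2)[of y]] by (simp add: algebra_simps)
  qed
  have P_scl: "P (scl c x) = scl c (P x)" for c x
  proof (rule P_eqI)
    show "scl c (P x) \<in> Y" using P by (simp add: scl_Y)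
    show "scl c x - scl c (P x) \<in> K"
      using scl_K[OF P(2)[of x], of c] by (simp add: V.scale_right_diff_distrib)
  qed
  have P_Y: "P y = y" if "y \<in> Y" for y
    using that subspace_K by (intro P_eqI) (auto simp: subspace_0)
  have same_coset: "P u = P x" if "x - u \<in> K" for x u
  proof (rule P_eqI)
    show "u - P x \<in> K" using subspace_diff[OF subspace_K P(2)[of x] that] by simp
  qed (rule P)
  have "linear_projection scl P"
    using P_add P_scl P_Y P(1) V.vector_space_axioms
    by (auto simp: linear_projection_def Vector_Spaces.linear_iff)
  moreover have "bounded_linear P"
    using P_add P(3) P_scl[of "of_real _"]
    by (intro bounded_linear_intro[of P 1]) (simp_all add: V.scl_of_real)
  moreover have "range P = Y" using P(1) P_Y by (auto simp: image_iff) metis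
  moreover have "P \<circ> P\<^sub>1 = P" "P \<circ> P\<^sub>2 = P" using same_coset move by (auto simp: fun_eq_iff)
  ultimately show ?thesis unfolding consistent_def Y_def by blast
qed

end
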